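(* Let $R$ be a commutative Artinian ring with identity that is not an integral domain. Then: (i) $\omega(\Gamma_{reg}(R))=\chi(\Gamma_{reg}(R))$. (ii) If $R$ is reduced, then $\omega(\Gamma_{reg}(R))=|\mathrm{Max}(R)|-1$.
   Context: $\mathrm{Max}(R)$ is the set of maximal ideals of $R$; $R$ is reduced if it has no non-zero nilpotent element. An ideal is non-trivial if it is neither $(0)$ nor the whole ring. For a commutative ring $R$ with identity and an ideal $J$ of $R$, an element $x\in R$ is called $J$-regular if it is not a zero-divisor on $J$, i.e. $xy\neq 0$ for every $0\neq y\in J$. The regular graph of ideals $\Gamma_{reg}(R)$ is the simple undirected graph whose vertices are the non-trivial ideals of $R$, two distinct vertices $I,J$ being adjacent if and only if $I$ contains a $J$-regular element or $J$ contains an $I$-regular element. For a graph $G$, $\omega(G)$ is the clique number and $\chi(G)$ the vertex chromatic number. *)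

theory Defs
  imports "HOL-Algebra.Ideal" "HOL-Library.Ramsey" "HOL-Library.Extended_Nat"
begin

section \<open>Clique number and chromatic number\<close>

text \<open>
  A simple graph is given by a vertex set \<open>V\<close> and a set \<open>E\<close> of two-element subsets of \<open>V\<close>, as for
  \<^const>\<open>clique\<close>. Vertex sets may be infinite, so both invariants take values in \<^typ>\<open>enat\<close>.
\<close>

text \<open>
  Restricting to finite cliques avoids \<^const>\<open>card\<close> being \<open>0\<close> on infinite sets; subsets of cliques
  are cliques, so an infinite clique still yields the value \<open>\<infinity>\<close>.
\<close>
definition clique_number :: "'a set \<Rightarrow> 'a set set \<Rightarrow> enat" where
  "clique_number V E = (SUP C \<in> {C. C \<subseteq> V \<and> finite C \<and> clique C E}. enat (card C))"

definition proper_colouring :: "'a set \<Rightarrow> 'a set set \<Rightarrow> nat \<Rightarrow> ('a \<Rightarrow> nat) \<Rightarrow> bool" where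
  "proper_colouring V E k c \<longleftrightarrow>
     (\<forall>v\<in>V. c v < k) \<and> (\<forall>v\<in>V. \<forall>w\<in>V. {v, w} \<in> E \<longrightarrow> c v \<noteq> c w)"

text \<open>The infimum of the empty set is \<open>\<infinity>\<close>: the value when no finite number of colours suffices.\<close>
definition chromatic_number :: "'a set \<Rightarrow> 'a set set \<Rightarrow> enat" where
  "chromatic_number V E = (INF k \<in> {k. \<exists>c. proper_colouring V E k c}. enat k)"

definition ecard :: "'a set \<Rightarrow> enat" where
  "ecard A = (if finite A then enat (card A) else \<infinity>)"


section \<open>Artinian rings, reduced rings, maximal ideals\<close>

locale artinian_cring = cring +
  assumes descending_chain_condition:
    "\<lbrakk>\<And>n::nat. ideal (I n) R; \<And>n. I (Suc n) \<subseteq> I n\<rbrakk> \<Longrightarrow> \<exists>N. \<forall>n\<ge>N. I n = I N"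

definition reduced :: "('a, 'b) ring_scheme \<Rightarrow> bool" where
  "reduced R \<longleftrightarrow> (\<forall>x \<in> carrier R. \<forall>n::nat. x [^]\<^bsub>R\<^esub> n = \<zero>\<^bsub>R\<^esub> \<longrightarrow> x = \<zero>\<^bsub>R\<^esub>)"

definition max_ideals :: "('a, 'b) ring_scheme \<Rightarrow> 'a set set" where
  "max_ideals R = {M. maximalideal M R}"


section \<open>The regular graph of ideals\<close>

definition regular_on :: "('a, 'b) ring_scheme \<Rightarrow> 'a set \<Rightarrow> 'a \<Rightarrow> bool" where
  "regular_on R J x \<longleftrightarrow>
     x \<in> carrier R \<and> (\<forall>y \<in> J. y \<noteq> \<zero>\<^bsub>R\<^esub> \<longrightarrow> x \<otimes>\<^bsub>R\<^esub> y \<noteq> \<zero>\<^bsub>R\<^esub>)"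

definition nontrivial_ideals :: "('a, 'b) ring_scheme \<Rightarrow> 'a set set" where
  "nontrivial_ideals R = {I. ideal I R \<and> I \<noteq> {\<zero>\<^bsub>R\<^esub>} \<and> I \<noteq> carrier R}"

definition reg_graph_edges :: "('a, 'b) ring_scheme \<Rightarrow> 'a set set set" where
  "reg_graph_edges R = {{I, J} | I J.
     I \<in> nontrivial_ideals R \<and> J \<in> nontrivial_ideals R \<and> I \<noteq> J \<and>
     ((\<exists>x \<in> I. regular_on R J x) \<or> (\<exists>x \<in> J. regular_on R I x))}"

definition omega_reg :: "('a, 'b) ring_scheme \<Rightarrow> enat" where
  "omega_reg R = clique_number (nontrivial_ideals R) (reg_graph_edges R)"

definition chi_reg :: "('a, 'b) ring_scheme \<Rightarrow> enat" where
  "chi_reg R = chromatic_number (nontrivial_ideals R) (reg_graph_edges R)"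

end

theory Submission
  imports Defs
begin

text \<open>
  Everything is read off from the finite set \<open>P\<close> of primitive idempotents of the Artinian ring \<open>R\<close>.
  They are orthogonal with sum \<open>\<one>\<close>, so \<open>R\<close> is the product of the components \<open>pR\<close>, and each component
  is local. Attach to an ideal \<open>I\<close> the set \<open>S(I)\<close> of those \<open>p\<close> for which the component \<open>pI\<close> is nonzero
  (\<open>support\<close>) and the set \<open>U(I) \<subseteq> S(I)\<close> of those for which it is all of \<open>pR\<close> (\<open>full_support\<close>).

  In an Artinian ring some power of an element \<open>x\<close> generates the same ideal as an idempotent lying in
  \<open>xR\<close>. This replaces regular elements by idempotents: \<open>I\<close> contains a \<open>J\<close>-regular element iff
  \<open>S(J) \<subseteq> U(I)\<close> (\<open>contains_regular_iff\<close>). From here the problem is combinatorial. Let \<open>F\<close> be the set of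
  \<open>p\<close> whose component is not a field, that is, those lying in \<open>S(I) - U(I)\<close> for some \<open>I\<close>. Both invariants
  are equal to \<open>|P| - 1 + |F|\<close>, with truncated subtraction because \<open>P\<close> is empty for the zero ring:

  \<^item> Colouring. If \<open>S(I) = U(I)\<close>, use the number \<open>|U(I)|\<close>, one of \<open>1, \<dots>, |P| - 1\<close>. Otherwise use
    \<open>|U(I) \<inter> F|\<close>, one of \<open>0, \<dots>, |F| - 1\<close>, from a separate palette. Adjacency means \<open>S(J) \<subseteq> U(I)\<close> up to
    order, and this inclusion makes the number strictly larger for \<open>I\<close> than for \<open>J\<close> whenever both ideals
    use the same palette and are distinct (\<open>reg_graph_colouring\<close>).

  \<^item> Clique. Enumerate \<open>P\<close>. Take the products of the first \<open>k\<close> components for \<open>0 < k < |P|\<close>, and for every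
    \<open>q \<in> F\<close> the product of all components before \<open>q\<close> with a proper nonzero ideal of \<open>qR\<close>. Their
    supports are interleaved along the enumeration (\<open>reg_graph_clique\<close>).

  In a reduced ring \<open>F\<close> is empty, since a nonzero \<open>x \<in> pR\<close> has a nonzero idempotent in \<open>xR\<close>, and this
  can only be \<open>p\<close>. The maximal ideals are then the annihilators of the primitive idempotents, so
  \<open>|P| = |Max(R)|\<close>.
\<close>

section \<open>Cliques and colourings\<close>

lemma clique_card_le_colours:
  assumes "C \<subseteq> V" "clique C E" "proper_colouring V E k c"
  shows "card C \<le> k"
proof -
  have "inj_on c C"
    using assms unfolding clique_def proper_colouring_def inj_on_def by blast
  moreover have "c ` C \<subseteq> {..<k}"
    using assms unfolding proper_colouring_def by auto
  ultimately show ?thesis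
    using card_inj_on_le[of c C "{..<k}"] by simp
qed

lemma clique_and_chromatic_number_eqI:
  assumes "C \<subseteq> V" "finite C" "clique C E" "card C = k" "proper_colouring V E k c"
  shows "clique_number V E = enat k" and "chromatic_number V E = enat k"
proof -
  have "clique_number V E \<le> enat k"
    unfolding clique_number_def
    using clique_card_le_colours[OF _ _ assms(5)] by (auto intro!: SUP_least)
  moreover have "enat k \<le> clique_number V E"
    unfolding clique_number_def using assms by (intro SUP_upper2[of C]) auto
  ultimately show "clique_number V E = enat k" by simp
  have "enat k \<le> chromatic_number V E"
    unfolding chromatic_number_def
    using clique_card_le_colours[OF assms(1,3)] assms(4) by (auto intro!: INF_greatest)
  moreover have "chromatic_number V E \<le> enat k"
    unfolding chromatic_number_def using assms(5) by (intro INF_lower) auto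
  ultimately show "chromatic_number V E = enat k" by simp
qed

section \<open>Idempotents in Artinian rings\<close>

context cring
begin

text \<open>
  Every ideal built by hand below has this form: annihilators, where each \<open>K a\<close> is zero, and products
  of components, where \<open>A\<close> is a complete set of orthogonal idempotents.
\<close>
lemma ideal_of_multipliers:
  assumes "A \<subseteq> carrier R" "\<And>a. a \<in> A \<Longrightarrow> ideal (K a) R"
  shows "ideal {x \<in> carrier R. \<forall>a\<in>A. a \<otimes> x \<in> K a} R"
proof (rule idealI)
  show "ring R" by (rule ring_axioms)
  show "subgroup {x \<in> carrier R. \<forall>a\<in>A. a \<otimes> x \<in> K a} (add_monoid R)"
  proof (rule add.subgroupI)
    have "\<zero> \<in> K a" if "a \<in> A" for a
      using assms(2)[OF that] by (simp add: additive_subgroup.zero_closed ideal.axioms(1))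
    then have "\<zero> \<in> {x \<in> carrier R. \<forall>a\<in>A. a \<otimes> x \<in> K a}"
      using assms(1) by auto
    then show "{x \<in> carrier R. \<forall>a\<in>A. a \<otimes> x \<in> K a} \<noteq> {}" by blast
  next
    fix x assume x: "x \<in> {x \<in> carrier R. \<forall>a\<in>A. a \<otimes> x \<in> K a}"
    have "a \<otimes> (\<ominus> x) \<in> K a" if "a \<in> A" for a
      using x that assms by (auto simp: r_minus subset_iff additive_subgroup.a_inv_closed ideal.axioms(1))
    then show "\<ominus> x \<in> {x \<in> carrier R. \<forall>a\<in>A. a \<otimes> x \<in> K a}" using x by simp
  next
    fix x y assume "x \<in> {x \<in> carrier R. \<forall>a\<in>A. a \<otimes> x \<in> K a}"
      and "y \<in> {x \<in> carrier R. \<forall>a\<in>A. a \<otimes> x \<in> K a}"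
    then show "x \<oplus> y \<in> {x \<in> carrier R. \<forall>a\<in>A. a \<otimes> x \<in> K a}"
      using assms by (auto simp: r_distr subset_iff additive_subgroup.a_closed ideal.axioms(1))
  qed auto
next
  fix x r assume x: "x \<in> {x \<in> carrier R. \<forall>a\<in>A. a \<otimes> x \<in> K a}" and r: "r \<in> carrier R"
  have "a \<otimes> (r \<otimes> x) \<in> K a" if "a \<in> A" for a
  proof -
    have "r \<otimes> (a \<otimes> x) \<in> K a" using that x r assms by (auto intro: ideal.I_l_closed)
    moreover have "r \<otimes> (a \<otimes> x) = a \<otimes> (r \<otimes> x)"
      using that x r assms(1) by (auto simp: m_lcomm subset_iff)
    ultimately show ?thesis by simp
  qed
  then show "r \<otimes> x \<in> {x \<in> carrier R. \<forall>a\<in>A. a \<otimes> x \<in> K a}" using x r by simp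
  then show "x \<otimes> r \<in> {x \<in> carrier R. \<forall>a\<in>A. a \<otimes> x \<in> K a}" using x r by (simp add: m_comm)
qed

definition idempotent :: "'a \<Rightarrow> bool" where
  "idempotent e \<longleftrightarrow> e \<in> carrier R \<and> e \<otimes> e = e"

definition primitive_idempotents :: "'a set" where
  "primitive_idempotents =
     {p. idempotent p \<and> p \<noteq> \<zero> \<and> (\<forall>e. idempotent e \<longrightarrow> e \<otimes> p = e \<longrightarrow> e = \<zero> \<or> e = p)}"

lemma primitive_closed: "p \<in> primitive_idempotents \<Longrightarrow> p \<in> carrier R"
  and primitive_idem: "p \<in> primitive_idempotents \<Longrightarrow> p \<otimes> p = p"
  and primitive_nonzero: "p \<in> primitive_idempotents \<Longrightarrow> p \<noteq> \<zero>"
  by (auto simp: primitive_idempotents_def idempotent_def)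

lemma idempotent_mult:
  assumes "idempotent e" "idempotent f"
  shows "idempotent (e \<otimes> f)"
proof -
  have "e \<in> carrier R" "f \<in> carrier R" using assms by (auto simp: idempotent_def)
  then have "(e \<otimes> f) \<otimes> (e \<otimes> f) = (e \<otimes> e) \<otimes> (f \<otimes> f)"
    by (simp add: m_ac)
  then show ?thesis using assms by (simp add: idempotent_def)
qed

lemma idempotent_times_primitive:
  assumes "idempotent e" "p \<in> primitive_idempotents"
  shows "e \<otimes> p = \<zero> \<or> e \<otimes> p = p"
proof -
  have "idempotent p" using assms(2) by (simp add: primitive_idempotents_def)
  then have "idempotent (e \<otimes> p)" using idempotent_mult assms(1) by blast
  moreover have "(e \<otimes> p) \<otimes> p = e \<otimes> p"
    using assms \<open>idempotent p\<close> by (simp add: idempotent_def m_assoc)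
  ultimately show ?thesis using assms(2) by (auto simp: primitive_idempotents_def)
qed

lemma primitives_orthogonal:
  assumes "p \<in> primitive_idempotents" "q \<in> primitive_idempotents" "p \<noteq> q"
  shows "p \<otimes> q = \<zero>"
proof -
  have "idempotent p" "idempotent q" using assms by (auto simp: primitive_idempotents_def)
  then have "p \<otimes> q = \<zero> \<or> p \<otimes> q = q" "q \<otimes> p = \<zero> \<or> q \<otimes> p = p"
    using idempotent_times_primitive assms by auto
  moreover have "p \<otimes> q = q \<otimes> p" using assms by (simp add: m_comm primitive_closed)
  ultimately show ?thesis using assms(3) by auto
qed

end

context artinian_cring
begin

text \<open>
  The descending chain of the powers of \<open>xR\<close> stabilises, so \<open>y = x\<^sup>m\<close> satisfies \<open>y = r y\<^sup>2\<close> for some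
  \<open>r\<close>; then \<open>e = y r\<close> is idempotent and acts as the identity on \<open>y\<close>.
\<close>
lemma idempotent_from_powers:
  assumes x: "x \<in> carrier R"
  obtains e r k where "idempotent e" "r \<in> carrier R" "e = x \<otimes> r"
    "e \<otimes> x [^] (k::nat) = x [^] k"
proof -
  have "\<exists>N. \<forall>n::nat\<ge>N. PIdl (x [^] n) = PIdl (x [^] N)"
  proof (rule descending_chain_condition)
    fix n :: nat
    show "ideal (PIdl (x [^] n)) R" using x by (simp add: cgenideal_ideal)
    show "PIdl (x [^] (Suc n)) \<subseteq> PIdl (x [^] n)"
    proof
      fix y assume "y \<in> PIdl (x [^] (Suc n))"
      then obtain s where s: "s \<in> carrier R" "y = s \<otimes> x [^] (Suc n)"
        by (auto simp: cgenideal_def)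
      have "y = (s \<otimes> x) \<otimes> x [^] n" using s x by (simp add: m_ac)
      then show "y \<in> PIdl (x [^] n)" using s x by (auto simp: cgenideal_def)
    qed
  qed
  then obtain N :: nat where N: "\<And>n. n \<ge> N \<Longrightarrow> PIdl (x [^] n) = PIdl (x [^] N)" by blast
  \<comment> \<open>A positive exponent, so that the idempotent is a multiple of \<open>x\<close>.\<close>
  define m where "m = Suc N"
  have "x [^] m \<in> PIdl (x [^] m)" using x by (simp add: cgenideal_self)
  also have "PIdl (x [^] m) = PIdl (x [^] (m + m))"
    using N[of m] N[of "m + m"] by (simp add: m_def)
  finally obtain r where r: "r \<in> carrier R" "x [^] m = r \<otimes> x [^] (m + m)"
    by (auto simp: cgenideal_def)
  define y where "y = x [^] m"
  have y: "y \<in> carrier R" "y = x \<otimes> x [^] N"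
    using x by (simp_all add: y_def m_def m_comm)
  have "y \<otimes> y = x [^] (m + m)" using x by (simp only: y_def nat_pow_mult)
  then have y_eq: "r \<otimes> (y \<otimes> y) = y" using r(2) by (simp only: y_def)
  let ?e = "y \<otimes> r"
  have fix_power: "?e \<otimes> y = y"
  proof -
    have "?e \<otimes> y = r \<otimes> (y \<otimes> y)" using y(1) r(1) by (simp add: m_ac)
    then show ?thesis using y_eq by simp
  qed
  have "?e \<otimes> ?e = (?e \<otimes> y) \<otimes> r" using y(1) r(1) by (simp add: m_assoc)
  then have "idempotent ?e" using fix_power y(1) r(1) by (simp add: idempotent_def)
  moreover have "?e = x \<otimes> (x [^] N \<otimes> r)" using x r(1) by (simp add: y(2) m_assoc)
  moreover have "x [^] N \<otimes> r \<in> carrier R" using x r(1) by simp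
  ultimately show ?thesis using that fix_power by (metis y_def)
qed

text \<open>
  Otherwise one could split off proper nonzero parts of \<open>e\<close> forever, and the principal ideals that they
  generate would form a strictly descending chain.
\<close>
lemma primitive_below_idempotent:
  assumes "idempotent e" "e \<noteq> \<zero>"
  obtains p where "p \<in> primitive_idempotents" "p \<otimes> e = p"
proof (rule ccontr)
  assume "\<not> thesis"
  then have neg: "p \<otimes> e \<noteq> p" if "p \<in> primitive_idempotents" for p
    using \<open>\<And>p. p \<in> primitive_idempotents \<Longrightarrow> p \<otimes> e = p \<Longrightarrow> thesis\<close> that by blast
  let ?Q = "\<lambda>f. idempotent f \<and> f \<noteq> \<zero> \<and> f \<otimes> e = f"
  have step: "\<exists>g. ?Q g \<and> g \<otimes> f = g \<and> g \<noteq> f" if f: "?Q f" for f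
  proof -
    have "f \<notin> primitive_idempotents" using neg f by blast
    then obtain g where g: "idempotent g" "g \<otimes> f = g" "g \<noteq> \<zero>" "g \<noteq> f"
      using f by (auto simp: primitive_idempotents_def)
    have "g \<otimes> e = g \<otimes> (f \<otimes> e)"
      using g f assms(1) by (metis idempotent_def m_assoc)
    then show ?thesis using g f by auto
  qed
  have "?Q e" using assms by (simp add: idempotent_def)
  then have "\<exists>f. \<forall>n::nat. ?Q (f n) \<and> (f (Suc n) \<otimes> f n = f (Suc n) \<and> f (Suc n) \<noteq> f n)"
    using step by (intro dependent_nat_choice) auto
  then obtain f where f: "\<And>n::nat. ?Q (f n)"
    "\<And>n. f (Suc n) \<otimes> f n = f (Suc n)" "\<And>n. f (Suc n) \<noteq> f n" by blast
  have car: "f n \<in> carrier R" "f n \<otimes> f n = f n" for n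
    using f(1) by (auto simp: idempotent_def)
  have "\<exists>N. \<forall>n\<ge>N. PIdl (f n) = PIdl (f N)"
  proof (rule descending_chain_condition)
    fix n
    show "ideal (PIdl (f n)) R" using car by (simp add: cgenideal_ideal)
    show "PIdl (f (Suc n)) \<subseteq> PIdl (f n)"
    proof
      fix y assume "y \<in> PIdl (f (Suc n))"
      then obtain s where s: "s \<in> carrier R" "y = s \<otimes> f (Suc n)" by (auto simp: cgenideal_def)
      have "y = (s \<otimes> f (Suc n)) \<otimes> f n" using s car f(2)[of n] by (simp add: m_assoc)
      then show "y \<in> PIdl (f n)" using s car by (auto simp: cgenideal_def)
    qed
  qed
  then obtain N where "PIdl (f (Suc N)) = PIdl (f N)" by (meson le_SucI order_refl)
  then have "f N \<in> PIdl (f (Suc N))" using car by (simp add: cgenideal_self)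
  then obtain s where s: "s \<in> carrier R" "f N = s \<otimes> f (Suc N)" by (auto simp: cgenideal_def)
  have "f (Suc N) \<otimes> f N = f N" using s car[of "Suc N"] by (simp add: m_lcomm)
  then show False using f(2,3)[of N] by simp
qed

text \<open>
  For an infinite sequence \<open>p 0, p 1, \<dots>\<close> of primitive idempotents, the annihilators of the initial
  segments would descend strictly: by orthogonality \<open>p N\<close> is killed by its predecessors, but not by
  itself.
\<close>
lemma finite_primitives: "finite primitive_idempotents"
proof (rule ccontr)
  assume "infinite primitive_idempotents"
  then obtain p :: "nat \<Rightarrow> 'a" where p: "inj p" "range p \<subseteq> primitive_idempotents"
    using infinite_countable_subset by blast
  let ?I = "\<lambda>n. {x \<in> carrier R. \<forall>a\<in>p ` {..<n}. a \<otimes> x \<in> {\<zero>}}"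
  have car: "p i \<in> carrier R" for i using p primitive_closed by blast
  have "\<exists>N. \<forall>n\<ge>N. ?I n = ?I N"
  proof (rule descending_chain_condition)
    fix n
    show "ideal (?I n) R"
      by (rule ideal_of_multipliers) (use car zeroideal in auto)
    show "?I (Suc n) \<subseteq> ?I n" by auto
  qed
  then obtain N where "?I (Suc N) = ?I N" by (meson le_SucI order_refl)
  moreover have "p N \<in> ?I N"
    using p car by (auto intro!: primitives_orthogonal simp: inj_eq)
  ultimately have "p N \<otimes> p N = \<zero>" by auto
  then show False using p(2) primitive_idem primitive_nonzero by (metis rangeI subsetD)
qed

lemma primitive_times_sum:
  assumes A: "A \<subseteq> primitive_idempotents" and p: "p \<in> primitive_idempotents"
  shows "p \<otimes> (\<Oplus>q\<in>A. q) = (if p \<in> A then p else \<zero>)"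
proof -
  have fin: "finite A" using A finite_primitives finite_subset by blast
  have "p \<otimes> (\<Oplus>q\<in>A. q) = (\<Oplus>q\<in>A. p \<otimes> q)"
    using A p primitive_closed by (intro finsum_rdistr) (auto simp: fin)
  also have "\<dots> = (\<Oplus>q\<in>A. if p = q then p else \<zero>)"
    using A p by (intro finsum_cong') (auto simp: primitives_orthogonal primitive_idem primitive_closed)
  also have "\<dots> = (if p \<in> A then p else \<zero>)"
  proof (cases "p \<in> A")
    case True
    then show ?thesis using add.finprod_singleton[OF True fin, of "\<lambda>_. p"] p
      by (simp add: primitive_closed)
  next
    case False
    then have "(\<Oplus>q\<in>A. if p = q then p else \<zero>) = (\<Oplus>q\<in>A. \<zero>)"
      by (intro finsum_cong') auto
    then show ?thesis using False by simp
  qed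
  finally show ?thesis .
qed

text \<open>
  The complement of the sum is an idempotent annihilated by every primitive idempotent, so no primitive
  idempotent lies below it.
\<close>
lemma sum_primitives: "(\<Oplus>p\<in>primitive_idempotents. p) = \<one>"
proof (rule ccontr)
  let ?s = "\<Oplus>p\<in>primitive_idempotents. p"
  assume neq: "?s \<noteq> \<one>"
  have s: "?s \<in> carrier R" using primitive_closed by (intro finsum_closed) auto
  have kill: "p \<otimes> (\<one> \<ominus> ?s) = \<zero>" if "p \<in> primitive_idempotents" for p
    using primitive_times_sum[OF order_refl that] that s
    by (simp add: primitive_closed minus_eq r_distr r_minus r_neg)
  have "?s \<otimes> (\<one> \<ominus> ?s) = (\<Oplus>p\<in>primitive_idempotents. p \<otimes> (\<one> \<ominus> ?s))"
    using s primitive_closed by (intro finsum_ldistr) (auto simp: finite_primitives)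
  also have "\<dots> = (\<Oplus>p\<in>primitive_idempotents. \<zero>)"
    using kill by (intro finsum_cong') auto
  finally have "?s \<otimes> (\<one> \<ominus> ?s) = \<zero>" by simp
  then have "idempotent (\<one> \<ominus> ?s)"
    using s by (simp add: idempotent_def minus_eq l_distr l_minus)
  moreover have "\<one> \<ominus> ?s \<noteq> \<zero>"
    using neq s minus_equality[of \<one> "\<ominus> ?s"] by (auto simp: minus_eq)
  ultimately obtain p where "p \<in> primitive_idempotents" "p \<otimes> (\<one> \<ominus> ?s) = p"
    using primitive_below_idempotent by blast
  then show False using kill primitive_nonzero by metis
qed

lemma component_decomposition:
  assumes "x \<in> carrier R"
  shows "(\<Oplus>p\<in>primitive_idempotents. p \<otimes> x) = x"
proof -
  have "(\<Oplus>p\<in>primitive_idempotents. p) \<otimes> x = (\<Oplus>p\<in>primitive_idempotents. p \<otimes> x)"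
    using assms primitive_closed by (intro finsum_ldistr) (auto simp: finite_primitives)
  then show ?thesis using assms by (simp add: sum_primitives)
qed

section \<open>Supports of ideals\<close>

text \<open>
  With \<open>R\<close> viewed as the product of the components \<open>pR\<close>, these are the indices at which an ideal is
  nonzero, and those at which it is the whole component.
\<close>
definition support :: "'a set \<Rightarrow> 'a set" where
  "support I = {p \<in> primitive_idempotents. \<exists>x\<in>I. p \<otimes> x \<noteq> \<zero>}"

definition full_support :: "'a set \<Rightarrow> 'a set" where
  "full_support I = primitive_idempotents \<inter> I"

lemma full_support_subset: "full_support I \<subseteq> support I"
proof
  fix p assume "p \<in> full_support I"
  then have "p \<in> primitive_idempotents" "p \<in> I" "p \<otimes> p \<noteq> \<zero>"
    by (auto simp: full_support_def primitive_idem primitive_nonzero)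
  then show "p \<in> support I" unfolding support_def by blast
qed

lemma support_subset: "support I \<subseteq> primitive_idempotents"
  by (auto simp: support_def)

lemma finite_support: "finite (support I)" "finite (full_support I)"
  using finite_subset[OF support_subset finite_primitives]
    finite_subset[OF full_support_subset] by blast+

lemma ideal_finsum:
  assumes I: "ideal I R" and fin: "finite A" and mem: "\<And>a. a \<in> A \<Longrightarrow> f a \<in> I"
  shows "(\<Oplus>a\<in>A. f a) \<in> I"
  using fin mem
proof (induction A)
  case empty
  then show ?case using I by (simp add: additive_subgroup.zero_closed ideal.axioms(1))
next
  case (insert a A)
  have "f \<in> insert a A \<rightarrow> carrier R"
    using insert.prems ideal.Icarr[OF I] by blast
  then show ?case
    using insert I by (auto simp: additive_subgroup.a_closed ideal.axioms(1))
qed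

lemma mem_ideal_if_components:
  assumes "ideal I R" "x \<in> carrier R" "\<And>p. p \<in> primitive_idempotents \<Longrightarrow> p \<otimes> x \<in> I"
  shows "x \<in> I"
  using ideal_finsum[OF assms(1) finite_primitives, of "\<lambda>p. p \<otimes> x"] assms(3)
    component_decomposition[OF assms(2)]
  by simp

lemma regular_power:
  assumes "ideal J R" "regular_on R J x"
  shows "regular_on R J (x [^] (k::nat))"
proof (induction k)
  case 0
  show ?case using ideal.Icarr[OF assms(1)] by (simp add: regular_on_def)
next
  case (Suc k)
  have x: "x \<in> carrier R" using assms(2) by (simp add: regular_on_def)
  have "x [^] Suc k \<otimes> y \<noteq> \<zero>" if y: "y \<in> J" "y \<noteq> \<zero>" for y
  proof -
    have "x \<otimes> y \<in> J" "x \<otimes> y \<noteq> \<zero>"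
      using y assms x by (auto simp: regular_on_def ideal.I_l_closed)
    then have "x [^] k \<otimes> (x \<otimes> y) \<noteq> \<zero>" using Suc by (simp add: regular_on_def)
    then show ?thesis using x ideal.Icarr[OF assms(1)] y by (simp add: m_assoc)
  qed
  then show ?case using x by (simp add: regular_on_def)
qed

text \<open>
  The bridge from regularity to supports. If \<open>x \<in> I\<close> is \<open>J\<close>-regular then so are its powers, hence the
  idempotent \<open>e \<in> xR\<close> that fixes a power of \<open>x\<close> cannot kill any \<open>p\<close> in the support of \<open>J\<close>; as \<open>p\<close> is
  primitive, \<open>p = ep \<in> I\<close>. Conversely, the sum of the primitive idempotents in the support of \<open>J\<close> acts
  as the identity on \<open>J\<close>.
\<close>
lemma contains_regular_iff:
  assumes I: "ideal I R" and J: "ideal J R"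
  shows "(\<exists>x\<in>I. regular_on R J x) \<longleftrightarrow> support J \<subseteq> full_support I"
proof
  assume "\<exists>x\<in>I. regular_on R J x"
  then obtain x where x: "x \<in> I" "regular_on R J x" by blast
  have xc: "x \<in> carrier R" using ideal.Icarr[OF I] x by blast
  obtain e r k where e: "idempotent e" "r \<in> carrier R" "e = x \<otimes> r" "e \<otimes> x [^] (k::nat) = x [^] k"
    using idempotent_from_powers[OF xc] by blast
  have eI: "e \<in> I" "e \<in> carrier R" using I x e xc by (auto simp: ideal.I_r_closed)
  show "support J \<subseteq> full_support I"
  proof
    fix p assume "p \<in> support J"
    then obtain y where p: "p \<in> primitive_idempotents" and y: "y \<in> J" "p \<otimes> y \<noteq> \<zero>"
      by (auto simp: support_def)
    have yc: "y \<in> carrier R" and pc: "p \<in> carrier R"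
      using ideal.Icarr[OF J] y primitive_closed p by blast+
    have "p \<otimes> y \<in> J" using J y pc by (simp add: ideal.I_l_closed)
    then have nz: "x [^] k \<otimes> (p \<otimes> y) \<noteq> \<zero>"
      using regular_power[OF J x(2), of k] y by (simp add: regular_on_def)
    have "x [^] k \<otimes> (p \<otimes> y) = (e \<otimes> x [^] k) \<otimes> (p \<otimes> y)" using e(4) by simp
    also have "\<dots> = x [^] k \<otimes> ((e \<otimes> p) \<otimes> y)" using xc yc pc eI by (simp add: m_ac)
    finally have "e \<otimes> p \<noteq> \<zero>" using nz xc yc by auto
    then have "e \<otimes> p = p" using idempotent_times_primitive[OF e(1) p] by blast
    then have "p \<in> I" using ideal.I_r_closed[OF I eI(1) pc] by simp
    then show "p \<in> full_support I" using p by (simp add: full_support_def)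
  qed
next
  assume sub: "support J \<subseteq> full_support I"
  let ?e = "\<Oplus>p\<in>support J. p"
  have eI: "?e \<in> I"
    using sub by (intro ideal_finsum[OF I finite_support(1)]) (auto simp: full_support_def)
  have ec: "?e \<in> carrier R" using ideal.Icarr[OF I eI] .
  have "?e \<otimes> y = y" if y: "y \<in> J" for y
  proof -
    have yc: "y \<in> carrier R" using ideal.Icarr[OF J y] .
    have "?e \<otimes> y = (\<Oplus>p\<in>support J. p \<otimes> y)"
      using yc by (intro finsum_ldistr finite_support) (auto simp: support_def primitive_closed)
    also have "\<dots> = (\<Oplus>p\<in>primitive_idempotents. p \<otimes> y)"
      using y yc primitive_closed finite_primitives support_subset
      by (intro add.finprod_mono_neutral_cong_left) (auto simp: support_def)
    also have "\<dots> = y" by (rule component_decomposition[OF yc])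
    finally show ?thesis .
  qed
  then have "regular_on R J ?e" using ec by (auto simp: regular_on_def)
  then show "\<exists>x\<in>I. regular_on R J x" using eI by blast
qed

lemma reg_graph_edge_iff:
  assumes "I \<in> nontrivial_ideals R" "J \<in> nontrivial_ideals R"
  shows "{I, J} \<in> reg_graph_edges R \<longleftrightarrow>
    I \<noteq> J \<and> (support J \<subseteq> full_support I \<or> support I \<subseteq> full_support J)"
proof -
  have "{I, J} \<in> reg_graph_edges R \<longleftrightarrow>
    I \<noteq> J \<and> ((\<exists>x \<in> I. regular_on R J x) \<or> (\<exists>x \<in> J. regular_on R I x))"
    using assms by (auto simp: reg_graph_edges_def doubleton_eq_iff)
  then show ?thesis
    using assms contains_regular_iff by (simp add: nontrivial_ideals_def)
qed

lemma nontrivial_ideals_iff: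
  assumes I: "ideal I R"
  shows "I \<in> nontrivial_ideals R \<longleftrightarrow> support I \<noteq> {} \<and> full_support I \<noteq> primitive_idempotents"
proof -
  have "I = {\<zero>} \<longleftrightarrow> support I = {}"
  proof
    assume "support I = {}"
    have "x = \<zero>" if "x \<in> I" for x
    proof -
      have "x \<in> {\<zero>}"
        by (rule mem_ideal_if_components[OF zeroideal])
          (use \<open>support I = {}\<close> that ideal.Icarr[OF I that] in \<open>auto simp: support_def\<close>)
      then show ?thesis by simp
    qed
    then show "I = {\<zero>}"
      using additive_subgroup.zero_closed[OF ideal.axioms(1)[OF I]] by blast
  qed (auto simp: support_def primitive_closed)
  moreover have "I = carrier R \<longleftrightarrow> full_support I = primitive_idempotents"
  proof
    assume "full_support I = primitive_idempotents"
    then have "\<one> \<in> I"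
      using ideal_finsum[OF I finite_primitives, of "\<lambda>p. p"] sum_primitives
      by (auto simp: full_support_def)
    then show "I = carrier R" using ideal.one_imp_carrier[OF I] by blast
  qed (auto simp: full_support_def primitive_closed)
  ultimately show ?thesis using I by (simp add: nontrivial_ideals_def)
qed

text \<open>
  Used in both directions at once: two ideals with \<open>S(I) = U(I) = S(J) = U(J)\<close> coincide.
\<close>
lemma ideal_subset_if_support_subset:
  assumes I: "ideal I R" and J: "ideal J R" and sub: "support I \<subseteq> full_support J"
  shows "I \<subseteq> J"
proof
  fix x assume x: "x \<in> I"
  have xc: "x \<in> carrier R" using ideal.Icarr[OF I x] .
  show "x \<in> J"
  proof (rule mem_ideal_if_components[OF J xc])
    fix p assume p: "p \<in> primitive_idempotents"
    show "p \<otimes> x \<in> J"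
    proof (cases "p \<otimes> x = \<zero>")
      case True
      then show ?thesis using additive_subgroup.zero_closed[OF ideal.axioms(1)[OF J]] by simp
    next
      case False
      then have "p \<in> J" using sub p x by (auto simp: support_def full_support_def)
      then show ?thesis using ideal.I_r_closed[OF J _ xc] by blast
    qed
  qed
qed

text \<open>
  The component \<open>pR\<close> fails to be a field exactly if it has an ideal other than zero and itself; such
  an ideal is \<open>pI\<close> for an ideal \<open>I\<close> of \<open>R\<close> with \<open>p \<in> S(I) - U(I)\<close>.
\<close>
definition non_field_primitives :: "'a set" where
  "non_field_primitives = {p. \<exists>I. ideal I R \<and> p \<in> support I - full_support I}"

lemma non_field_primitives_subset: "non_field_primitives \<subseteq> primitive_idempotents"
  by (auto simp: non_field_primitives_def support_def)

lemma finite_non_field_primitives: "finite non_field_primitives"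
  using finite_subset[OF non_field_primitives_subset finite_primitives] .

section \<open>A colouring and a clique\<close>

text \<open>
  The two palettes are \<open>{0..<|P| - 1}\<close> and the next \<open>|F|\<close> numbers. Suppose \<open>S(J) \<subseteq> U(I)\<close>. In the first
  palette \<open>U(J) = S(J) \<subseteq> U(I) = S(I)\<close>, so equal cardinalities force \<open>I = J\<close>. In the second palette some
  \<open>p \<in> S(J) - U(J)\<close> belongs to \<open>F\<close> and to \<open>U(I)\<close>, so \<open>U(J) \<inter> F\<close> is a proper subset of \<open>U(I) \<inter> F\<close>.
\<close>
lemma reg_graph_colouring:
  fixes c
  defines "c \<equiv> \<lambda>I. if full_support I = support I then card (full_support I) - 1
    else card primitive_idempotents - 1 + card (full_support I \<inter> non_field_primitives)"
  shows "proper_colouring (nontrivial_ideals R) (reg_graph_edges R)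
    (card primitive_idempotents - 1 + card non_field_primitives) c"
  unfolding proper_colouring_def
proof (intro conjI ballI impI)
  fix I assume I: "I \<in> nontrivial_ideals R"
  then have idl: "ideal I R" by (simp add: nontrivial_ideals_def)
  have ne: "support I \<noteq> {}" "full_support I \<noteq> primitive_idempotents"
    using I nontrivial_ideals_iff[OF idl] by auto
  show "c I < card primitive_idempotents - 1 + card non_field_primitives"
  proof (cases "full_support I = support I")
    case True
    have "full_support I \<subset> primitive_idempotents" using ne by (auto simp: full_support_def)
    then have "card (full_support I) < card primitive_idempotents"
      using finite_primitives by (rule psubset_card_mono[rotated])
    moreover have "card (full_support I) > 0" using ne(1) True finite_support[of I] by auto
    ultimately show ?thesis using True by (simp add: c_def)
  next
    case False
    then obtain p where "p \<in> support I - full_support I" using full_support_subset by blast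
    then have "p \<in> non_field_primitives" "p \<notin> full_support I"
      using idl by (auto simp: non_field_primitives_def)
    then have "full_support I \<inter> non_field_primitives \<subset> non_field_primitives" by blast
    then have "card (full_support I \<inter> non_field_primitives) < card non_field_primitives"
      using finite_non_field_primitives by (rule psubset_card_mono[rotated])
    then show ?thesis using False by (simp add: c_def)
  qed
next
  have no_clash: "c I \<noteq> c J" if I: "I \<in> nontrivial_ideals R" and J: "J \<in> nontrivial_ideals R"
    and "I \<noteq> J" and sub: "support J \<subseteq> full_support I" for I J
  proof
    assume eq: "c I = c J"
    have idl: "ideal I R" "ideal J R" using I J by (auto simp: nontrivial_ideals_def)
    have chain: "full_support J \<subseteq> support J" "full_support I \<subseteq> support I"
      by (auto intro: full_support_subset[THEN subsetD])
    have pos: "card A > 0" "card A - 1 < card primitive_idempotents - 1"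
      if "A = full_support K" "full_support K = support K" "K \<in> nontrivial_ideals R" for A K
    proof -
      have K: "support K \<noteq> {}" "full_support K \<noteq> primitive_idempotents"
        using that(3) nontrivial_ideals_iff[of K] by (auto simp: nontrivial_ideals_def)
      show pos: "card A > 0" using that K finite_support[of K] by (simp add: card_gt_0_iff)
      have "A \<subset> primitive_idempotents" using K that(1) by (auto simp: full_support_def)
      then have "card A < card primitive_idempotents"
        using finite_primitives by (rule psubset_card_mono[rotated])
      then show "card A - 1 < card primitive_idempotents - 1" using pos by linarith
    qed
    \<comment> \<open>The palettes are disjoint, so equal colours come from the same palette.\<close>
    have "full_support I = support I \<longleftrightarrow> full_support J = support J"
      using eq pos(2)[OF refl _ I] pos(2)[OF refl _ J] by (auto simp: c_def split: if_splits)
    then consider "full_support I = support I" "full_support J = support J"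
      | "full_support I \<noteq> support I" "full_support J \<noteq> support J"
      by blast
    then show False
    proof cases
      case 1
      then have "card (full_support J) = card (full_support I)"
        using eq pos(1)[OF refl _ I] pos(1)[OF refl _ J] by (simp add: c_def)
      then have "full_support J = full_support I"
        using sub 1 finite_support[of I] by (intro card_subset_eq) auto
      then have "support I \<subseteq> full_support J" using 1(1) by simp
      then have "I \<subseteq> J" "J \<subseteq> I"
        using ideal_subset_if_support_subset[OF idl] sub
          ideal_subset_if_support_subset[OF idl(2,1)] by simp_all
      then show False using \<open>I \<noteq> J\<close> by blast
    next
      case 2
      then obtain p where "p \<in> support J - full_support J" using chain by blast
      then have "full_support J \<inter> non_field_primitives \<subset> full_support I \<inter> non_field_primitives"
        using idl sub chain by (auto simp: non_field_primitives_def)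
      then have "card (full_support J \<inter> non_field_primitives)
          < card (full_support I \<inter> non_field_primitives)"
        using finite_non_field_primitives by (intro psubset_card_mono) auto
      then show False using eq 2 by (simp add: c_def)
    qed
  qed
  fix I J assume I: "I \<in> nontrivial_ideals R" and J: "J \<in> nontrivial_ideals R"
    and edge: "{I, J} \<in> reg_graph_edges R"
  then show "c I \<noteq> c J"
    using reg_graph_edge_iff[OF I J] no_clash[OF I J] no_clash[OF J I] by metis
qed

text \<open>
  The ideal \<open>\<Oplus>p. pK(p)\<close> is described by membership of the components. It inherits both supports at
  index \<open>p\<close> from \<open>K p\<close> alone, because the other primitive idempotents annihilate \<open>p\<close>.
\<close>
lemma ideal_with_components:
  assumes K: "\<And>p. p \<in> primitive_idempotents \<Longrightarrow> ideal (K p) R"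
  defines "I \<equiv> {x \<in> carrier R. \<forall>p\<in>primitive_idempotents. p \<otimes> x \<in> K p}"
  shows "ideal I R"
    and "full_support I = {p \<in> primitive_idempotents. p \<in> full_support (K p)}"
    and "support I = {p \<in> primitive_idempotents. p \<in> support (K p)}"
proof -
  show "ideal I R"
    unfolding I_def by (rule ideal_of_multipliers) (use K primitive_closed in auto)
  have zero: "\<zero> \<in> K p" if "p \<in> primitive_idempotents" for p
    using additive_subgroup.zero_closed[OF ideal.axioms(1)[OF K[OF that]]] .
  have component: "p \<otimes> x \<in> I" if "p \<in> primitive_idempotents" "x \<in> K p" for p x
  proof -
    have xc: "x \<in> carrier R" using ideal.Icarr[OF K[OF that(1)] that(2)] .
    have "q \<otimes> (p \<otimes> x) \<in> K q" if q: "q \<in> primitive_idempotents" for q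
    proof (cases "q = p")
      case True
      then show ?thesis using \<open>x \<in> K p\<close> K q primitive_closed by (auto intro!: ideal.I_l_closed)
    next
      case False
      have "q \<otimes> (p \<otimes> x) = (q \<otimes> p) \<otimes> x"
        using q \<open>p \<in> primitive_idempotents\<close> xc by (simp add: m_assoc primitive_closed)
      then show ?thesis
        using primitives_orthogonal[OF q _ False] \<open>p \<in> primitive_idempotents\<close> xc zero[OF q] by simp
    qed
    then show ?thesis using that xc primitive_closed by (simp add: I_def)
  qed
  show "full_support I = {p \<in> primitive_idempotents. p \<in> full_support (K p)}"
  proof (intro equalityI subsetI)
    fix p assume "p \<in> full_support I"
    then show "p \<in> {p \<in> primitive_idempotents. p \<in> full_support (K p)}"
      using primitive_idem by (force simp: full_support_def I_def)
  next
    fix p assume "p \<in> {p \<in> primitive_idempotents. p \<in> full_support (K p)}"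
    then show "p \<in> full_support I"
      using component[of p p] primitive_idem by (auto simp: full_support_def)
  qed
  have absorb: "p \<otimes> (p \<otimes> x) = p \<otimes> x" if "p \<in> primitive_idempotents" "x \<in> carrier R" for p x
    using that by (metis m_assoc primitive_closed primitive_idem)
  show "support I = {p \<in> primitive_idempotents. p \<in> support (K p)}"
  proof (intro equalityI subsetI)
    fix p assume "p \<in> support I"
    then obtain x where x: "p \<in> primitive_idempotents" "x \<in> I" "p \<otimes> x \<noteq> \<zero>"
      by (auto simp: support_def)
    then have "p \<otimes> x \<in> K p" "p \<otimes> (p \<otimes> x) \<noteq> \<zero>" using absorb by (auto simp: I_def)
    then show "p \<in> {p \<in> primitive_idempotents. p \<in> support (K p)}"
      using x(1) by (auto simp: support_def)
  next
    fix p assume "p \<in> {p \<in> primitive_idempotents. p \<in> support (K p)}"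
    then obtain x where x: "p \<in> primitive_idempotents" "x \<in> K p" "p \<otimes> x \<noteq> \<zero>"
      by (auto simp: support_def)
    then have "p \<otimes> x \<in> I" "p \<otimes> (p \<otimes> x) \<noteq> \<zero>"
      using component absorb ideal.Icarr[OF K] by auto
    then show "p \<in> support I" using x(1) by (auto simp: support_def)
  qed
qed

text \<open>
  Choose each component separately: everything at indices in \<open>A\<close>, a proper nonzero ideal at those in
  \<open>B - A\<close>, and zero outside \<open>B\<close>.
\<close>
lemma ideal_with_prescribed_supports:
  assumes "A \<subseteq> B" "B \<subseteq> primitive_idempotents" "B - A \<subseteq> non_field_primitives"
  obtains I where "ideal I R" "full_support I = A" "support I = B"
proof -
  have "\<forall>p\<in>primitive_idempotents. \<exists>L. ideal L R \<and> (p \<in> full_support L \<longleftrightarrow> p \<in> A) \<and>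
    (p \<in> support L \<longleftrightarrow> p \<in> B)"
  proof
    fix p assume p: "p \<in> primitive_idempotents"
    consider "p \<in> A" | "p \<in> B - A" | "p \<notin> B" using assms(1) by blast
    then show "\<exists>L. ideal L R \<and> (p \<in> full_support L \<longleftrightarrow> p \<in> A) \<and> (p \<in> support L \<longleftrightarrow> p \<in> B)"
    proof cases
      case 1
      have "p \<in> full_support (carrier R)" using p primitive_closed by (simp add: full_support_def)
      then show ?thesis using 1 oneideal assms(1) full_support_subset by blast
    next
      case 2
      then show ?thesis using assms(3) by (auto simp: non_field_primitives_def)
    next
      case 3
      have "p \<notin> support {\<zero>}" using p primitive_closed by (simp add: support_def)
      then show ?thesis using 3 zeroideal assms(1) full_support_subset by blast
    qed
  qed
  then obtain K where K: "\<And>p. p \<in> primitive_idempotents \<Longrightarrow>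
    ideal (K p) R \<and> (p \<in> full_support (K p) \<longleftrightarrow> p \<in> A) \<and> (p \<in> support (K p) \<longleftrightarrow> p \<in> B)"
    by metis
  note components = ideal_with_components[of K, OF conjunct1[OF K]]
  show ?thesis
    by (rule that[OF components(1)]) (use components(2,3) K assms in auto)
qed

text \<open>
  Along an enumeration of \<open>P\<close>, the ideal \<open>E k\<close> consists of the first \<open>k\<close> components and \<open>N q\<close> adds to the
  components before \<open>q\<close> a proper nonzero part of the component of \<open>q\<close>. Both supports of all these ideals
  are initial segments, and for any two of them the support of one is contained in the full support of
  the other.
\<close>
lemma reg_graph_clique:
  obtains C where "C \<subseteq> nontrivial_ideals R" "finite C" "clique C (reg_graph_edges R)"
    "card C = card primitive_idempotents - 1 + card non_field_primitives"
proof -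
  define n where "n = card primitive_idempotents"
  obtain r where r: "bij_betw r primitive_idempotents {0..<n}"
    using ex_bij_betw_finite_nat[OF finite_primitives] by (auto simp: n_def)
  let ?P = "primitive_idempotents" and ?F = "non_field_primitives"
  define below where "below k = {p \<in> ?P. r p < k}" for k
  have below_subset: "below k \<subseteq> ?P" for k by (auto simp: below_def)
  have below_mono: "below j \<subseteq> below k" if "j \<le> k" for j k
    using that by (auto simp: below_def)
  have r_lt: "r p < n" if "p \<in> ?P" for p using r that by (auto simp: bij_betw_def)
  have r_inj: "p = q" if "p \<in> ?P" "q \<in> ?P" "r p = r q" for p q
    using r that by (auto simp: bij_betw_def inj_on_def)
  have r_surj: "\<exists>p\<in>?P. r p = k" if "k < n" for k
  proof -
    have "k \<in> r ` ?P" using that bij_betw_imp_surj_on[OF r] by simp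
    then show ?thesis by blast
  qed
  have FP: "p \<in> ?P" if "p \<in> ?F" for p using that non_field_primitives_subset by blast
  have "\<forall>k. \<exists>I. ideal I R \<and> full_support I = below k \<and> support I = below k"
    by (metis ideal_with_prescribed_supports below_subset Diff_cancel empty_subsetI order_refl)
  then obtain E where E: "\<And>k. ideal (E k) R" "\<And>k. full_support (E k) = below k"
    "\<And>k. support (E k) = below k" by metis
  have "\<forall>q\<in>?F. \<exists>I. ideal I R \<and> full_support I = below (r q) \<and> support I = below (Suc (r q))"
  proof
    fix q assume q: "q \<in> ?F"
    have "below (Suc (r q)) - below (r q) \<subseteq> ?F"
      using q r_inj FP by (auto simp: below_def less_Suc_eq)
    then show "\<exists>I. ideal I R \<and> full_support I = below (r q) \<and> support I = below (Suc (r q))"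
      by (metis ideal_with_prescribed_supports below_subset below_mono[of "r q" "Suc (r q)"] le_SucI order_refl)
  qed
  then obtain N where N: "\<And>q. q \<in> ?F \<Longrightarrow> ideal (N q) R"
    "\<And>q. q \<in> ?F \<Longrightarrow> full_support (N q) = below (r q)"
    "\<And>q. q \<in> ?F \<Longrightarrow> support (N q) = below (Suc (r q))" by metis
  have below_inj: "j = k" if "below j = below k" "j \<le> n" "k \<le> n" for j k
  proof -
    have "\<not> i < l" if "below i = below l" "l \<le> n" for i l
    proof
      assume "i < l"
      then obtain p where "p \<in> ?P" "r p = i" using r_surj[of i] \<open>l \<le> n\<close> by auto
      then have "p \<in> below l - below i" using \<open>i < l\<close> by (simp add: below_def)
      then show False using \<open>below i = below l\<close> by blast
    qed
    then show ?thesis using that by (metis linorder_neqE_nat)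
  qed
  let ?C = "E ` {1..<n} \<union> N ` ?F"
  have injE: "inj_on E {1..<n}"
  proof (rule inj_onI)
    fix j k assume "j \<in> {1..<n}" "k \<in> {1..<n}" "E j = E k"
    then have "below j = below k" using E(2) by metis
    then show "j = k" using below_inj \<open>j \<in> {1..<n}\<close> \<open>k \<in> {1..<n}\<close> by simp
  qed
  have injN: "inj_on N ?F"
  proof (rule inj_onI)
    fix p q assume pq: "p \<in> ?F" "q \<in> ?F" "N p = N q"
    have "below (r p) = below (r q)" using pq N(2) by metis
    then have "r p = r q"
      using below_inj r_lt[OF FP[OF pq(1)]] r_lt[OF FP[OF pq(2)]] by simp
    then show "p = q" using r_inj FP pq by blast
  qed
  have "E k \<noteq> N q" if q: "q \<in> ?F" for k q
  proof
    assume "E k = N q"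
    then have "below (r q) = below (Suc (r q))"
      using E(2,3)[of k] N(2,3)[OF q] by simp
    then have "r q = Suc (r q)" using r_lt[OF FP[OF q]] by (intro below_inj) auto
    then show False by simp
  qed
  then have disj: "E ` {1..<n} \<inter> N ` ?F = {}" by auto
  have card: "card ?C = n - 1 + card ?F"
    using disj finite_non_field_primitives card_image[OF injE] card_image[OF injN]
    by (simp add: card_Un_disjoint)
  have E_nontrivial: "E k \<in> nontrivial_ideals R" if "k \<in> {1..<n}" for k
  proof -
    have "0 < n" "k < n" using that by auto
    then obtain p q where "p \<in> ?P" "r p = 0" "q \<in> ?P" "r q = k"
      using r_surj by blast
    then have "p \<in> below k" "q \<notin> below k" using that by (auto simp: below_def)
    then show ?thesis
      using nontrivial_ideals_iff[OF E(1)] E(2,3) \<open>q \<in> ?P\<close> by auto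
  qed
  have N_nontrivial: "N q \<in> nontrivial_ideals R" if q: "q \<in> ?F" for q
  proof -
    have "q \<in> below (Suc (r q))" "q \<notin> below (r q)" using FP[OF q] by (auto simp: below_def)
    then show ?thesis
      using nontrivial_ideals_iff[OF N(1)[OF q]] N(2,3)[OF q] FP[OF q] by auto
  qed
  have vertices: "?C \<subseteq> nontrivial_ideals R" using E_nontrivial N_nontrivial by auto
  have "clique ?C (reg_graph_edges R)"
    unfolding clique_def
  proof (intro ballI impI)
    fix I J assume IJ: "I \<in> ?C" "J \<in> ?C" "I \<noteq> J"
    have comparable: "support J \<subseteq> full_support I \<or> support I \<subseteq> full_support J"
    proof -
      consider j k where "I = E j" "J = E k" | j q where "I = E j" "J = N q" "q \<in> ?F"
        | q j where "I = N q" "J = E j" "q \<in> ?F"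
        | p q where "I = N p" "J = N q" "p \<in> ?F" "q \<in> ?F" "p \<noteq> q"
        using IJ by blast
      then show ?thesis
      proof cases
        case 1
        then show ?thesis
          using E(2,3) below_mono[of j k] below_mono[of k j] by (cases "j \<le> k") auto
      next
        case 2
        then show ?thesis
          using E(2,3) N(2,3) below_mono[of j "r q"] below_mono[of "Suc (r q)" j]
          by (cases "j \<le> r q") auto
      next
        case 3
        then show ?thesis
          using E(2,3) N(2,3) below_mono[of j "r q"] below_mono[of "Suc (r q)" j]
          by (cases "j \<le> r q") auto
      next
        case 4
        then have "r p \<noteq> r q" using r_inj FP by blast
        then show ?thesis
          using 4 N(2,3) below_mono[of "Suc (r p)" "r q"] below_mono[of "Suc (r q)" "r p"]
          by (cases "r p < r q") auto
      qed
    qed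
    show "{I, J} \<in> reg_graph_edges R"
      using reg_graph_edge_iff[of I J] IJ vertices comparable by blast
  qed
  then show ?thesis
    using that[of ?C] vertices card finite_non_field_primitives by (simp add: n_def)
qed

text \<open>
  The size of the clique agrees with the number of colours, which pins down both invariants.
\<close>
theorem omega_chi_reg_formula:
  "omega_reg R = enat (card primitive_idempotents - 1 + card non_field_primitives)"
  "chi_reg R = enat (card primitive_idempotents - 1 + card non_field_primitives)"
proof -
  obtain C where "C \<subseteq> nontrivial_ideals R" "finite C" "clique C (reg_graph_edges R)"
    "card C = card primitive_idempotents - 1 + card non_field_primitives"
    using reg_graph_clique by blast
  from clique_and_chromatic_number_eqI[OF this reg_graph_colouring]
  show "omega_reg R = enat (card primitive_idempotents - 1 + card non_field_primitives)"
    "chi_reg R = enat (card primitive_idempotents - 1 + card non_field_primitives)"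
    by (simp_all add: omega_reg_def chi_reg_def)
qed

section \<open>Reduced rings\<close>

text \<open>
  If \<open>x \<in> I\<close> and \<open>y = px\<close> is nonzero, then \<open>y\<close> is not nilpotent, so the idempotent in \<open>yR\<close> that fixes a
  power of \<open>y\<close> is nonzero. It lies in \<open>pR\<close>, hence it equals \<open>p\<close>, and it lies in \<open>I\<close>.
\<close>
lemma reduced_no_non_field_primitives:
  assumes "reduced R"
  shows "non_field_primitives = {}"
proof -
  have "p \<in> full_support I" if I: "ideal I R" and "p \<in> support I" for p I
  proof -
    obtain x where p: "p \<in> primitive_idempotents" and x: "x \<in> I" "p \<otimes> x \<noteq> \<zero>"
      using \<open>p \<in> support I\<close> by (auto simp: support_def)
    have pc: "p \<in> carrier R" and xc: "x \<in> carrier R"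
      using p primitive_closed ideal.Icarr[OF I] x by auto
    let ?y = "p \<otimes> x"
    have y: "?y \<in> carrier R" "?y \<in> I" using pc xc I x by (auto simp: ideal.I_l_closed)
    obtain e r k where e: "idempotent e" "r \<in> carrier R" "e = ?y \<otimes> r"
      "e \<otimes> ?y [^] (k::nat) = ?y [^] k"
      using idempotent_from_powers[OF y(1)] by blast
    have "?y [^] k \<noteq> \<zero>" using assms x(2) y(1) by (auto simp: reduced_def)
    then have "e \<noteq> \<zero>" using e(4) y(1) by auto
    moreover have "e \<otimes> p = e"
    proof -
      have "e \<otimes> p = (p \<otimes> p) \<otimes> x \<otimes> r" using e(2,3) pc xc by (simp add: m_ac)
      then show ?thesis using e(3) primitive_idem[OF p] by simp
    qed
    ultimately have "e = p" using p e(1) by (auto simp: primitive_idempotents_def)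
    moreover have "e \<in> I" using e y I by (simp add: ideal.I_r_closed)
    ultimately show ?thesis using p by (simp add: full_support_def)
  qed
  then show ?thesis by (auto simp: non_field_primitives_def)
qed

text \<open>
  All components being fields, the maximal ideals are the products of all components but one, that is,
  the annihilators of the primitive idempotents.
\<close>
lemma reduced_card_max_ideals:
  assumes "reduced R"
  shows "ecard (max_ideals R) = enat (card primitive_idempotents)"
proof -
  let ?P = primitive_idempotents
  let ?M = "\<lambda>p. {x \<in> carrier R. \<forall>a\<in>{p}. a \<otimes> x \<in> {\<zero>}}"
  have field: "p \<in> I" if "ideal I R" "p \<in> ?P" "x \<in> I" "p \<otimes> x \<noteq> \<zero>" for p I x
    using reduced_no_non_field_primitives[OF assms] that
    by (auto simp: non_field_primitives_def support_def full_support_def)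
  have M_ideal: "ideal (?M p) R" if "p \<in> ?P" for p
    by (rule ideal_of_multipliers) (use that primitive_closed zeroideal in auto)
  have not_mem: "p \<notin> ?M p" if "p \<in> ?P" for p
    using that primitive_idem primitive_nonzero by auto
  have maximal: "maximalideal (?M p) R" if p: "p \<in> ?P" for p
  proof (rule maximalidealI)
    show "ideal (?M p) R" by (rule M_ideal[OF p])
    show "carrier R \<noteq> ?M p" using not_mem[OF p] primitive_closed[OF p] by blast
    fix J assume J: "ideal J R" "?M p \<subseteq> J" "J \<subseteq> carrier R"
    show "J = ?M p \<or> J = carrier R"
    proof (cases "J \<subseteq> ?M p")
      case False
      then obtain x where "x \<in> J" "p \<otimes> x \<noteq> \<zero>" using J(3) by auto
      then have pJ: "p \<in> J" using field[OF J(1) p] by blast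
      have pc: "p \<in> carrier R" using primitive_closed[OF p] .
      \<comment> \<open>Enlarging the annihilator of \<open>p\<close> puts \<open>p\<close> into the ideal, next to \<open>\<one> \<ominus> p\<close>.\<close>
      have "\<one> \<ominus> p \<in> ?M p"
        using pc primitive_idem[OF p] by (simp add: minus_eq r_distr r_minus r_neg)
      then have "(\<one> \<ominus> p) \<oplus> p \<in> J"
        using J pJ additive_subgroup.a_closed[OF ideal.axioms(1)[OF J(1)]] by blast
      moreover have "(\<one> \<ominus> p) \<oplus> p = \<one>" using pc by (simp add: minus_eq a_assoc l_neg)
      ultimately show ?thesis using ideal.one_imp_carrier[OF J(1)] by simp
    qed (use J in blast)
  qed
  have "max_ideals R = ?M ` ?P"
  proof (intro equalityI subsetI)
    fix L assume "L \<in> max_ideals R"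
    then have L: "maximalideal L R" by (simp add: max_ideals_def)
    then have Li: "ideal L R" by (simp add: maximalideal_def)
    have "\<not> ?P \<subseteq> L"
    proof
      assume "?P \<subseteq> L"
      then have "\<one> \<in> L"
        using ideal_finsum[OF Li finite_primitives, of "\<lambda>p. p"] sum_primitives by auto
      then show False
        using ideal.one_imp_carrier[OF Li] maximalideal.I_notcarr[OF L] by simp
    qed
    then obtain p where p: "p \<in> ?P" "p \<notin> L" by blast
    have "L \<subseteq> ?M p" using field[OF Li p(1)] p(2) ideal.Icarr[OF Li] by auto
    then have "?M p = L \<or> ?M p = carrier R"
      using maximalideal.I_maximal[OF L M_ideal[OF p(1)]] by auto
    moreover have "?M p \<noteq> carrier R" using not_mem[OF p(1)] primitive_closed[OF p(1)] by blast
    ultimately show "L \<in> ?M ` ?P" using p(1) by blast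
  qed (use maximal in \<open>auto simp: max_ideals_def\<close>)
  moreover have "inj_on ?M ?P"
  proof (rule inj_onI, rule ccontr)
    fix p q assume pq: "p \<in> ?P" "q \<in> ?P" "?M p = ?M q" "p \<noteq> q"
    have "p \<in> ?M q"
      using primitives_orthogonal[OF pq(2,1)] pq(4) primitive_closed[OF pq(1)] by auto
    then show False using not_mem[OF pq(1)] pq(3) by blast
  qed
  ultimately show ?thesis
    using finite_primitives by (simp add: ecard_def card_image)
qed

end

theorem corollary6:
  fixes R :: "('a, 'b) ring_scheme"
  assumes "artinian_cring R" and "\<not> domain R"
  shows "omega_reg R = chi_reg R \<and>
    (reduced R \<longrightarrow> omega_reg R = ecard (max_ideals R) - 1)"
proof -
  interpret artinian_cring R by (rule assms(1))
  have "enat (k - 1) = enat k - 1" for k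
    by (simp add: one_enat_def)
  then show ?thesis
    using reduced_no_non_field_primitives reduced_card_max_ideals
    by (simp add: omega_chi_reg_formula)
qed

end
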